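(* Let $n\geq 1$. (a) The only automorphism of $\mathrm{K}_n$ is the identity. (b) The map $a_i\mapsto a_{n-i+1}$, $i=1,\dots,n$, extends uniquely to an antiautomorphism of $\mathrm{K}_n$, and this is the only antiautomorphism of $\mathrm{K}_n$.
   Context: For a positive integer $n$, Kiselman's semigroup $\mathrm{K}_n$ is the monoid (with unit element $e$) given by the monoid presentation with generators $a_1,\dots,a_n$ and relations $a_i^2=a_i$ for $i=1,\dots,n$, and $a_ia_ja_i=a_ja_ia_j=a_ja_i$ for all $1\leq i<j\leq n$. An antiautomorphism of $\mathrm{K}_n$ is a bijection $\sigma:\mathrm{K}_n\to\mathrm{K}_n$ with $\sigma(xy)=\sigma(y)\sigma(x)$ for all $x,y$. *)

theory Defs
  imports "HOL-Algebra.Bij"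
begin

inductive_set pres_cong :: "'a set \<Rightarrow> ('a list \<times> 'a list) set \<Rightarrow> ('a list \<times> 'a list) set"
  for A :: "'a set" and R :: "('a list \<times> 'a list) set"
where
  refl: "u \<in> lists A \<Longrightarrow> (u, u) \<in> pres_cong A R"
| sym: "(u, v) \<in> pres_cong A R \<Longrightarrow> (v, u) \<in> pres_cong A R"
| trans: "(u, v) \<in> pres_cong A R \<Longrightarrow> (v, w) \<in> pres_cong A R \<Longrightarrow> (u, w) \<in> pres_cong A R"
| rel: "(u, v) \<in> R \<Longrightarrow> u \<in> lists A \<Longrightarrow> v \<in> lists A \<Longrightarrow> x \<in> lists A \<Longrightarrow> y \<in> lists A
    \<Longrightarrow> (x @ u @ y, x @ v @ y) \<in> pres_cong A R"

definition pres_class :: "'a set \<Rightarrow> ('a list \<times> 'a list) set \<Rightarrow> 'a list \<Rightarrow> 'a list set"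
  where "pres_class A R w = pres_cong A R `` {w}"

text \<open>The product of two classes is the class of the concatenation of any representatives;
  the union below is over a family of equal sets (see \<open>pres_class_mult\<close>).\<close>

definition presented_monoid :: "'a set \<Rightarrow> ('a list \<times> 'a list) set \<Rightarrow> 'a list set monoid"
  where "presented_monoid A R =
    \<lparr>carrier = lists A // pres_cong A R,
     mult = (\<lambda>X Y. \<Union>x\<in>X. \<Union>y\<in>Y. pres_class A R (x @ y)),
     one = pres_class A R []\<rparr>"

definition kiselman_rels :: "nat \<Rightarrow> (nat list \<times> nat list) set"
  where "kiselman_rels n =
    {([i, i], [i]) | i. i \<in> {1..n}}
    \<union> {([i, j, i], [j, i]) | i j. 1 \<le> i \<and> i < j \<and> j \<le> n}
    \<union> {([j, i, j], [j, i]) | i j. 1 \<le> i \<and> i < j \<and> j \<le> n}"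

definition kiselman :: "nat \<Rightarrow> nat list set monoid"
  where "kiselman n = presented_monoid {1..n} (kiselman_rels n)"

definition kiselman_gen :: "nat \<Rightarrow> nat \<Rightarrow> nat list set"
  where "kiselman_gen n i = pres_class {1..n} (kiselman_rels n) [i]"

text \<open>As with \<^const>\<open>auto\<close>, maps are normalised to be \<^const>\<open>undefined\<close> outside the carrier
  (this is part of \<^const>\<open>Bij\<close>), so that equality of maps means equality on the carrier.\<close>

definition antiauto :: "('a, 'b) monoid_scheme \<Rightarrow> ('a \<Rightarrow> 'a) set"
  where "antiauto G = {\<sigma> \<in> Bij (carrier G).
    \<forall>x\<in>carrier G. \<forall>y\<in>carrier G. \<sigma> (x \<otimes>\<^bsub>G\<^esub> y) = \<sigma> y \<otimes>\<^bsub>G\<^esub> \<sigma> x}"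

lemma pres_cong_lists: "(u, v) \<in> pres_cong A R \<Longrightarrow> u \<in> lists A \<and> v \<in> lists A"
  by (induction rule: pres_cong.induct) auto

lemma equiv_pres_cong: "equiv (lists A) (pres_cong A R)"
proof (rule equivI)
  show "pres_cong A R \<subseteq> lists A \<times> lists A"
    using pres_cong_lists by fastforce
  show "refl_on (lists A) (pres_cong A R)"
    by (auto simp: refl_on_def intro: pres_cong.refl)
  show "sym_on UNIV (pres_cong A R)"
    by (rule symI) (rule pres_cong.sym)
  show "trans_on UNIV (pres_cong A R)"
    by (rule transI) (rule pres_cong.trans)
qed

lemma pres_cong_append_left:
  "(u, v) \<in> pres_cong A R \<Longrightarrow> w \<in> lists A \<Longrightarrow> (w @ u, w @ v) \<in> pres_cong A R"
proof (induction rule: pres_cong.induct)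
  case (rel u v x y)
  then show ?case
    using pres_cong.rel[of u v R A "w @ x" y] by simp
next
  case (refl u)
  then show ?case
    by (intro pres_cong.refl) auto
next
  case (sym u v)
  show ?case
    by (rule pres_cong.sym[OF sym.IH[OF sym.prems]])
next
  case (trans u v z)
  show ?case
    by (rule pres_cong.trans[OF trans.IH(1)[OF trans.prems] trans.IH(2)[OF trans.prems]])
qed

lemma pres_cong_append_right:
  "(u, v) \<in> pres_cong A R \<Longrightarrow> w \<in> lists A \<Longrightarrow> (u @ w, v @ w) \<in> pres_cong A R"
proof (induction rule: pres_cong.induct)
  case (rel u v x y)
  then show ?case
    using pres_cong.rel[of u v R A x "y @ w"] by simp
next
  case (refl u)
  then show ?case
    by (intro pres_cong.refl) auto
next
  case (sym u v)
  show ?case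
    by (rule pres_cong.sym[OF sym.IH[OF sym.prems]])
next
  case (trans u v z)
  show ?case
    by (rule pres_cong.trans[OF trans.IH(1)[OF trans.prems] trans.IH(2)[OF trans.prems]])
qed

lemma pres_cong_append:
  assumes "(u, u') \<in> pres_cong A R" "(v, v') \<in> pres_cong A R"
  shows "(u @ v, u' @ v') \<in> pres_cong A R"
proof (rule pres_cong.trans)
  show "(u @ v, u' @ v) \<in> pres_cong A R"
    using assms pres_cong_lists by (intro pres_cong_append_right) blast+
  show "(u' @ v, u' @ v') \<in> pres_cong A R"
    using assms pres_cong_lists by (intro pres_cong_append_left) blast+
qed

lemma pres_class_eq_iff:
  "u \<in> lists A \<Longrightarrow> v \<in> lists A \<Longrightarrow>
    pres_class A R u = pres_class A R v \<longleftrightarrow> (u, v) \<in> pres_cong A R"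
  unfolding pres_class_def by (rule eq_equiv_class_iff[OF equiv_pres_cong])

lemma pres_class_mult:
  assumes "u \<in> lists A" "v \<in> lists A"
  shows "pres_class A R u \<otimes>\<^bsub>presented_monoid A R\<^esub> pres_class A R v = pres_class A R (u @ v)"
proof -
  have eq: "pres_class A R (x @ y) = pres_class A R (u @ v)"
    if "x \<in> pres_class A R u" "y \<in> pres_class A R v" for x y
  proof -
    have "(u @ v, x @ y) \<in> pres_cong A R"
      using that by (intro pres_cong_append) (simp_all add: pres_class_def)
    then show ?thesis
      using pres_cong_lists[of "u @ v" "x @ y" A R] pres_class_eq_iff[of "u @ v" A "x @ y" R]
      by simp
  qed
  have mem: "u \<in> pres_class A R u" "v \<in> pres_class A R v"
    using assms pres_cong.refl by (simp_all add: pres_class_def)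
  have "pres_class A R u \<otimes>\<^bsub>presented_monoid A R\<^esub> pres_class A R v =
      (\<Union>x\<in>pres_class A R u. \<Union>y\<in>pres_class A R v. pres_class A R (x @ y))"
    by (simp add: presented_monoid_def)
  also have "\<dots> = (\<Union>x\<in>pres_class A R u. \<Union>y\<in>pres_class A R v. pres_class A R (u @ v))"
    by (intro SUP_cong HOL.refl eq)
  also have "\<dots> = pres_class A R (u @ v)"
    using mem by blast
  finally show ?thesis .
qed

lemma carrier_presented_monoid:
  "carrier (presented_monoid A R) = pres_class A R ` lists A"
  by (auto simp: presented_monoid_def quotient_def pres_class_def)

lemma monoid_presented_monoid: "monoid (presented_monoid A R)"
proof -
  have one: "\<one>\<^bsub>presented_monoid A R\<^esub> = pres_class A R []"
    by (simp add: presented_monoid_def)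
  have cls: "\<exists>u\<in>lists A. x = pres_class A R u" if "x \<in> carrier (presented_monoid A R)" for x
    using that by (auto simp only: carrier_presented_monoid)
  show ?thesis
  proof
    fix x y assume "x \<in> carrier (presented_monoid A R)" "y \<in> carrier (presented_monoid A R)"
    then obtain u v where "u \<in> lists A" "v \<in> lists A" "x = pres_class A R u" "y = pres_class A R v"
      using cls by metis
    then show "x \<otimes>\<^bsub>presented_monoid A R\<^esub> y \<in> carrier (presented_monoid A R)"
      by (simp only: pres_class_mult carrier_presented_monoid) (rule imageI, simp)
  next
    fix x y z
    assume "x \<in> carrier (presented_monoid A R)" "y \<in> carrier (presented_monoid A R)"
      "z \<in> carrier (presented_monoid A R)"
    then obtain u v w where "u \<in> lists A" "v \<in> lists A" "w \<in> lists A"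
      "x = pres_class A R u" "y = pres_class A R v" "z = pres_class A R w"
      using cls by metis
    then show "x \<otimes>\<^bsub>presented_monoid A R\<^esub> y \<otimes>\<^bsub>presented_monoid A R\<^esub> z =
        x \<otimes>\<^bsub>presented_monoid A R\<^esub> (y \<otimes>\<^bsub>presented_monoid A R\<^esub> z)"
      by (simp add: pres_class_mult)
  next
    show "\<one>\<^bsub>presented_monoid A R\<^esub> \<in> carrier (presented_monoid A R)"
      unfolding one carrier_presented_monoid by (rule imageI) simp
  next
    fix x assume "x \<in> carrier (presented_monoid A R)"
    then obtain u where u: "u \<in> lists A" "x = pres_class A R u"
      using cls by metis
    show "\<one>\<^bsub>presented_monoid A R\<^esub> \<otimes>\<^bsub>presented_monoid A R\<^esub> x = x"
      using pres_class_mult[of "[]" A u R] u one by simp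
    show "x \<otimes>\<^bsub>presented_monoid A R\<^esub> \<one>\<^bsub>presented_monoid A R\<^esub> = x"
      using pres_class_mult[of u A "[]" R] u one by simp
  qed
qed

lemma presented_monoid_rel:
  "(u, v) \<in> R \<Longrightarrow> u \<in> lists A \<Longrightarrow> v \<in> lists A \<Longrightarrow> pres_class A R u = pres_class A R v"
  using pres_cong.rel[of u v R A "[]" "[]"] by (simp add: pres_class_eq_iff)

end

theory Submission
  imports Defs
begin

text \<open>The generators are the irreducible elements, so an automorphism permutes them.
  Whether some \<open>j\<close> precedes some \<open>i\<close> in a word is an invariant of its class when \<open>i < j\<close>, whence
  \<open>a\<^sub>i a\<^sub>j \<noteq> a\<^sub>j a\<^sub>i\<close>; so the relation \<open>a\<^sub>i a\<^sub>j a\<^sub>i = a\<^sub>j a\<^sub>i\<close>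
  recovers the order of the indices, and the permutation is increasing, hence trivial. Reversing
  words and indices gives an antiautomorphism, and composing any other antiautomorphism
  with it yields an automorphism.\<close>

declare One_nat_def [simp del]

section \<open>Irreducible elements of a monoid and bijective endomorphisms\<close>

lemma (in monoid) iso_one_eq:
  assumes h: "h \<in> hom G G" and b: "bij_betw h (carrier G) (carrier G)"
  shows "h \<one> = \<one>"
proof -
  obtain y where y: "y \<in> carrier G" "h y = \<one>"
    using b one_closed by (metis bij_betw_iff_bijections)
  \<comment> \<open>Membership in \<open>hom\<close> only asks for multiplicativity; the unit is
    reached through a preimage \<open>y\<close> of \<open>\<one>\<close>.\<close>
  have "h \<one> = h \<one> \<otimes> h y"
    using h y hom_in_carrier[OF h one_closed] by simp
  also have "\<dots> = h (\<one> \<otimes> y)"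
    using hom_mult[OF h one_closed y(1)] by simp
  finally show ?thesis
    using y by simp
qed

text \<open>The usual notion, asking one factor to be a unit, excludes every idempotent other than
  the unit, because of \<open>x = x \<otimes> x\<close>. Allowing the left factor to be
  \<open>x\<close> itself admits the idempotent generators. Only the left factor is constrained,
  which suits splitting off the first letter of a word.\<close>

definition monoid_irred :: "('a, 'b) monoid_scheme \<Rightarrow> 'a set"
  where "monoid_irred G = {x \<in> carrier G. x \<noteq> \<one>\<^bsub>G\<^esub> \<and>
    (\<forall>y\<in>carrier G. \<forall>z\<in>carrier G. x = y \<otimes>\<^bsub>G\<^esub> z \<longrightarrow> y = \<one>\<^bsub>G\<^esub> \<or> y = x)}"

text \<open>Surjectivity and injectivity of \<open>h\<close> pull each factorisation of
  \<open>h x\<close> back to one of \<open>x\<close>.\<close>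

lemma (in monoid) iso_monoid_irred:
  assumes h: "h \<in> hom G G" and b: "bij_betw h (carrier G) (carrier G)"
    and x: "x \<in> monoid_irred G"
  shows "h x \<in> monoid_irred G"
proof -
  have inj: "h u = h v \<longleftrightarrow> u = v" if "u \<in> carrier G" "v \<in> carrier G" for u v
    using b that by (meson bij_betw_def inj_on_eq_iff)
  have surj: "\<exists>v\<in>carrier G. h v = u" if "u \<in> carrier G" for u
    using b that by (metis bij_betw_iff_bijections)
  have xc: "x \<in> carrier G" and x1: "x \<noteq> \<one>"
    and xi: "\<And>y z. y \<in> carrier G \<Longrightarrow> z \<in> carrier G \<Longrightarrow> x = y \<otimes> z \<Longrightarrow> y = \<one> \<or> y = x"
    using x unfolding monoid_irred_def by blast+
  have h1: "h \<one> = \<one>"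
    by (rule iso_one_eq[OF h b])
  show ?thesis
    unfolding monoid_irred_def
  proof (intro CollectI conjI ballI impI)
    show "h x \<in> carrier G"
      by (rule hom_in_carrier[OF h xc])
    show "h x \<noteq> \<one>"
      using inj[OF xc one_closed] h1 x1 by simp
    fix y z assume yz: "y \<in> carrier G" "z \<in> carrier G" "h x = y \<otimes> z"
    obtain y' z' where y': "y' \<in> carrier G" "h y' = y" and z': "z' \<in> carrier G" "h z' = z"
      using surj[OF yz(1)] surj[OF yz(2)] by blast
    have "h x = h (y' \<otimes> z')"
      using yz y' z' hom_mult[OF h] by simp
    then have "x = y' \<otimes> z'"
      using inj xc y' z' by simp
    then have "y' = \<one> \<or> y' = x"
      using xi y' z' by simp
    then show "y = \<one> \<or> y = h x"
      using y' h1 by auto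
  qed
qed

section \<open>Irreducible elements of a presented monoid\<close>

lemma one_presented_monoid: "\<one>\<^bsub>presented_monoid A R\<^esub> = pres_class A R []"
  by (simp add: presented_monoid_def)

lemma pres_class_closed: "w \<in> lists A \<Longrightarrow> pres_class A R w \<in> carrier (presented_monoid A R)"
  unfolding carrier_presented_monoid by (rule imageI)

text \<open>The content of a word is an invariant of its class. It separates the letters from the
  empty word and from each other.\<close>

lemma pres_cong_set_eq:
  assumes "(u, v) \<in> pres_cong A R" and "\<And>u v. (u, v) \<in> R \<Longrightarrow> set u = set v"
  shows "set u = set v"
  using assms(1) by induction (auto simp: assms(2))

text \<open>A nonempty word is its first letter times the rest, so an irreducible class must be the
  class of that letter. Conversely, comparing contents shows that a left factor of the class of
  \<open>[i]\<close> is represented by a power of \<open>i\<close>, and idempotence collapses each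
  nonempty power to \<open>[i]\<close>.\<close>

lemma monoid_irred_presented_monoid:
  assumes R: "\<And>u v. (u, v) \<in> R \<Longrightarrow> set u = set v"
    and idem: "\<And>i. i \<in> A \<Longrightarrow> ([i, i], [i]) \<in> R"
  shows "monoid_irred (presented_monoid A R) = (\<lambda>i. pres_class A R [i]) ` A"
proof (intro equalityI subsetI)
  let ?G = "presented_monoid A R"
  have set_eq: "set u = set v" if "pres_class A R u = pres_class A R v" "u \<in> lists A" "v \<in> lists A" for u v
    using that by (intro pres_cong_set_eq[OF _ R]) (simp_all add: pres_class_eq_iff)
  {
    fix x assume x: "x \<in> monoid_irred ?G"
    then obtain w where w: "w \<in> lists A" "x = pres_class A R w"
      unfolding monoid_irred_def carrier_presented_monoid by blast
    have "w \<noteq> []"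
      using x w by (auto simp: monoid_irred_def one_presented_monoid)
    then obtain i v where iv: "w = i # v"
      by (cases w) auto
    then have A: "i \<in> A" "[i] \<in> lists A" "v \<in> lists A"
      using w by auto
    have "x = pres_class A R [i] \<otimes>\<^bsub>?G\<^esub> pres_class A R v"
      using A w iv by (simp add: pres_class_mult)
    then have "pres_class A R [i] = pres_class A R [] \<or> pres_class A R [i] = x"
      using x pres_class_closed[OF A(2), of R] pres_class_closed[OF A(3), of R]
      unfolding monoid_irred_def one_presented_monoid by blast
    moreover have "pres_class A R [i] \<noteq> pres_class A R []"
      using set_eq[of "[i]" "[]"] A by auto
    ultimately show "x \<in> (\<lambda>i. pres_class A R [i]) ` A"
      using A by blast
  }
  fix x assume "x \<in> (\<lambda>i. pres_class A R [i]) ` A"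
  then obtain i where i: "i \<in> A" "x = pres_class A R [i]"
    by blast
  have pow: "pres_class A R (replicate (Suc k) i) = pres_class A R [i]" for k
  proof (induction k)
    case (Suc k)
    have "([] @ [i, i] @ replicate k i, [] @ [i] @ replicate k i) \<in> pres_cong A R"
      using i by (intro pres_cong.rel idem) (auto simp: in_lists_conv_set)
    then have "pres_class A R (replicate (Suc (Suc k)) i) = pres_class A R (replicate (Suc k) i)"
      using i by (subst pres_class_eq_iff) (auto simp: in_lists_conv_set)
    then show ?case
      using Suc.IH by simp
  qed simp
  show "x \<in> monoid_irred ?G"
    unfolding monoid_irred_def
  proof (intro CollectI conjI ballI impI)
    show "x \<in> carrier ?G"
      using i by (auto intro: pres_class_closed)
    show "x \<noteq> \<one>\<^bsub>?G\<^esub>"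
      using set_eq[of "[i]" "[]"] i by (auto simp: one_presented_monoid)
    fix y z assume "y \<in> carrier ?G" "z \<in> carrier ?G" and x: "x = y \<otimes>\<^bsub>?G\<^esub> z"
    then obtain u v where uv: "u \<in> lists A" "v \<in> lists A" "y = pres_class A R u" "z = pres_class A R v"
      unfolding carrier_presented_monoid by blast
    then have "pres_class A R [i] = pres_class A R (u @ v)"
      using x i by (simp add: pres_class_mult)
    then have "set [i] = set (u @ v)"
      using uv i by (intro set_eq) auto
    then have "set u \<subseteq> {i}"
      by simp
    then have "u = replicate (length u) i"
      by (intro replicate_length_same[symmetric]) auto
    \<comment> \<open>The empty power gives the unit; all others have the form covered by
      \<open>pow\<close>.\<close>
    then have "u = [] \<or> (\<exists>k. u = replicate (Suc k) i)"
      by (cases "length u") auto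
    then show "y = \<one>\<^bsub>?G\<^esub> \<or> y = x"
      using pow uv i by (auto simp: one_presented_monoid simp del: replicate.simps)
  qed
qed

section \<open>Two-letter subsequences as invariants, and the order of the generators\<close>

fun occurs_before :: "'a \<Rightarrow> 'a \<Rightarrow> 'a list \<Rightarrow> bool"
  where
    "occurs_before a b [] \<longleftrightarrow> False"
  | "occurs_before a b (c # w) \<longleftrightarrow> c = a \<and> b \<in> set w \<or> occurs_before a b w"

lemma occurs_before_append:
  "occurs_before a b (u @ v) \<longleftrightarrow>
    occurs_before a b u \<or> occurs_before a b v \<or> a \<in> set u \<and> b \<in> set v"
  by (induction u) auto

lemma kiselman_rels_set_eq: "(u, v) \<in> kiselman_rels n \<Longrightarrow> set u = set v"
  by (auto simp: kiselman_rels_def)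

text \<open>In a relation between two letters, both sides contain the larger letter before the
  smaller one; an idempotence relation has only one letter. The opposite order is not invariant, as
  \<open>[i, j, i]\<close> and \<open>[j, i]\<close> show, hence \<open>i < j\<close>. Occurrences
  shared with the context \<open>x\<close>, \<open>y\<close> are controlled by equality of
  contents.\<close>

lemma pres_cong_kiselman_occurs_before:
  assumes "(u, v) \<in> pres_cong A (kiselman_rels n)" and "i < j"
  shows "occurs_before j i u \<longleftrightarrow> occurs_before j i v"
  using assms(1)
proof induction
  case (rel u v x y)
  then have "occurs_before j i u \<longleftrightarrow> occurs_before j i v"
    using \<open>i < j\<close> by (auto simp: kiselman_rels_def)
  then show ?case
    using kiselman_rels_set_eq[OF rel(1)] by (simp add: occurs_before_append)
qed auto

lemma carrier_kiselmanE:
  assumes "x \<in> carrier (kiselman n)"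
  obtains w where "w \<in> lists {1..n}" "x = pres_class {1..n} (kiselman_rels n) w"
  using assms unfolding kiselman_def carrier_presented_monoid by blast

lemma kiselman_gen_closed: "i \<in> {1..n} \<Longrightarrow> kiselman_gen n i \<in> carrier (kiselman n)"
  unfolding kiselman_gen_def kiselman_def by (rule pres_class_closed) simp

lemma kiselman_gen_eq_iff:
  assumes "i \<in> {1..n}" "j \<in> {1..n}"
  shows "kiselman_gen n i = kiselman_gen n j \<longleftrightarrow> i = j"
proof
  assume "kiselman_gen n i = kiselman_gen n j"
  then have "([i], [j]) \<in> pres_cong {1..n} (kiselman_rels n)"
    using assms by (simp add: kiselman_gen_def pres_class_eq_iff)
  then show "i = j"
    using pres_cong_set_eq[OF _ kiselman_rels_set_eq] by fastforce
qed simp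

lemma monoid_irred_kiselman:
  "monoid_irred (kiselman n) = kiselman_gen n ` {1..n}"
proof -
  have "monoid_irred (presented_monoid {1..n} (kiselman_rels n)) =
      (\<lambda>i. pres_class {1..n} (kiselman_rels n) [i]) ` {1..n}"
    by (rule monoid_irred_presented_monoid)
      (rule kiselman_rels_set_eq, assumption, auto simp: kiselman_rels_def)
  then show ?thesis
    unfolding kiselman_def by (simp add: kiselman_gen_def[abs_def])
qed

text \<open>This reads the order of the indices off the multiplication. If \<open>j < i\<close>,
  then \<open>i\<close> comes before \<open>j\<close> in \<open>[i, j, i]\<close> but not in
  \<open>[j, i]\<close>, contradicting the invariant. Equal indices are excluded because idempotence
  makes the equation hold for them.\<close>

lemma kiselman_gen_rel_iff:
  assumes "i \<in> {1..n}" "j \<in> {1..n}" "i \<noteq> j"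
  shows "kiselman_gen n i \<otimes>\<^bsub>kiselman n\<^esub> kiselman_gen n j \<otimes>\<^bsub>kiselman n\<^esub> kiselman_gen n i =
      kiselman_gen n j \<otimes>\<^bsub>kiselman n\<^esub> kiselman_gen n i \<longleftrightarrow> i < j" (is "?P \<longleftrightarrow> _")
proof -
  have "?P \<longleftrightarrow> ([i, j, i], [j, i]) \<in> pres_cong {1..n} (kiselman_rels n)"
    using assms by (simp add: kiselman_gen_def kiselman_def pres_class_mult pres_class_eq_iff)
  also have "\<dots> \<longleftrightarrow> i < j"
  proof
    assume c: "([i, j, i], [j, i]) \<in> pres_cong {1..n} (kiselman_rels n)"
    show "i < j"
    proof (rule ccontr)
      assume "\<not> i < j"
      then have "j < i"
        using assms by simp
      then show False
        using pres_cong_kiselman_occurs_before[OF c \<open>j < i\<close>] by simp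
    qed
  next
    assume "i < j"
    then show "([i, j, i], [j, i]) \<in> pres_cong {1..n} (kiselman_rels n)"
      using pres_cong.rel[of "[i, j, i]" "[j, i]" "kiselman_rels n" "{1..n}" "[]" "[]"] assms
      by (auto simp: kiselman_rels_def)
  qed
  finally show ?thesis .
qed

section \<open>Rigidity: automorphisms fix every element\<close>

lemma strict_mono_on_interval_id:
  fixes f :: "nat \<Rightarrow> nat"
  assumes mono: "strict_mono_on {a..b} f" and f: "f ` {a..b} \<subseteq> {a..b}" and i: "i \<in> {a..b}"
  shows "f i = i"
proof (rule antisym)
  have lt: "f x < f y" if "x < y" "x \<in> {a..b}" "y \<in> {a..b}" for x y
    using mono that by (simp add: strict_mono_on_def)
  have range: "a \<le> f x" "f x \<le> b" if "a \<le> x" "x \<le> b" for x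
    using f that by (auto simp: image_subset_iff)
  have "a \<le> i" "i \<le> b"
    using i by auto
  \<comment> \<open>Starting from \<open>a \<le> f a\<close>, each step up raises the value by at
    least one; the other inequality descends from \<open>f b \<le> b\<close> in the same
    way.\<close>
  show "i \<le> f i"
    using \<open>a \<le> i\<close> \<open>i \<le> b\<close>
  proof (induction i rule: dec_induct)
    case base
    then show ?case
      by (simp add: range)
  next
    case (step k)
    then have "f k < f (Suc k)"
      by (intro lt) auto
    then show ?case
      using step by auto
  qed
  show "f i \<le> i"
    using \<open>i \<le> b\<close> \<open>a \<le> i\<close>
  proof (induction i rule: inc_induct)
    case base
    then show ?case
      by (simp add: range)
  next
    case (step k)
    then have "f k < f (Suc k)"
      by (intro lt) auto
    then show ?case
      using step by auto
  qed
qed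

lemma monoid_kiselman: "monoid (kiselman n)"
  unfolding kiselman_def by (rule monoid_presented_monoid)

lemma kiselman_iso_gen:
  assumes h: "h \<in> hom (kiselman n) (kiselman n)"
    and b: "bij_betw h (carrier (kiselman n)) (carrier (kiselman n))"
    and i: "i \<in> {1..n}"
  shows "h (kiselman_gen n i) = kiselman_gen n i"
proof -
  have inj: "inj_on h (carrier (kiselman n))"
    using b by (simp add: bij_betw_def)
  \<comment> \<open>The irreducibles are exactly the generators, so \<open>h\<close> induces a map
    \<open>p\<close> on the indices.\<close>
  have "\<forall>i\<in>{1..n}. \<exists>j\<in>{1..n}. h (kiselman_gen n i) = kiselman_gen n j"
    using monoid.iso_monoid_irred[OF monoid_kiselman h b] unfolding monoid_irred_kiselman by blast
  then obtain p where p: "\<And>i. i \<in> {1..n} \<Longrightarrow> p i \<in> {1..n}"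
    and hp: "\<And>i. i \<in> {1..n} \<Longrightarrow> h (kiselman_gen n i) = kiselman_gen n (p i)"
    by metis
  have "strict_mono_on {1..n} p"
  proof (rule strict_mono_onI)
    fix r s assume rs: "r \<in> {1..n}" "s \<in> {1..n}" "r < s"
    let ?r = "kiselman_gen n r" and ?s = "kiselman_gen n s"
    have c: "?r \<in> carrier (kiselman n)" "?s \<in> carrier (kiselman n)"
      using rs by (auto intro: kiselman_gen_closed)
    \<comment> \<open>Distinct images are required before \<open>kiselman_gen_rel_iff\<close> can
      turn the transported relation into \<open>p r < p s\<close>.\<close>
    have "p r \<noteq> p s"
    proof
      assume "p r = p s"
      then have "h ?r = h ?s"
        using rs hp by simp
      then show False
        using inj_onD[OF inj _ c] rs kiselman_gen_eq_iff by auto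
    qed
    moreover have "?r \<otimes>\<^bsub>kiselman n\<^esub> ?s \<otimes>\<^bsub>kiselman n\<^esub> ?r = ?s \<otimes>\<^bsub>kiselman n\<^esub> ?r"
      using kiselman_gen_rel_iff[of r n s] rs by simp
    then have "h (?r \<otimes>\<^bsub>kiselman n\<^esub> ?s \<otimes>\<^bsub>kiselman n\<^esub> ?r) = h (?s \<otimes>\<^bsub>kiselman n\<^esub> ?r)"
      by simp
    then have "h ?r \<otimes>\<^bsub>kiselman n\<^esub> h ?s \<otimes>\<^bsub>kiselman n\<^esub> h ?r = h ?s \<otimes>\<^bsub>kiselman n\<^esub> h ?r"
      using c by (simp add: hom_mult[OF h] monoid.m_closed[OF monoid_kiselman])
    ultimately show "p r < p s"
      using kiselman_gen_rel_iff[of "p r" n "p s"] p rs hp by simp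
  qed
  then have "p i = i"
    using strict_mono_on_interval_id[of 1 n p i] p i by blast
  then show ?thesis
    using hp i by simp
qed

text \<open>The generators are fixed, and induction on a representing word extends this to all
  products.\<close>

lemma kiselman_iso_id:
  assumes h: "h \<in> hom (kiselman n) (kiselman n)"
    and b: "bij_betw h (carrier (kiselman n)) (carrier (kiselman n))"
    and x: "x \<in> carrier (kiselman n)"
  shows "h x = x"
proof -
  let ?c = "pres_class {1..n} (kiselman_rels n)"
  obtain w where w: "w \<in> lists {1..n}" "x = ?c w"
    using x by (rule carrier_kiselmanE)
  have "h (?c w) = ?c w"
    using w(1)
  proof (induction w)
    case Nil
    then show ?case
      using monoid.iso_one_eq[OF monoid_kiselman h b] by (simp add: kiselman_def one_presented_monoid)
  next
    case (Cons i w)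
    have eq: "?c (i # w) = kiselman_gen n i \<otimes>\<^bsub>kiselman n\<^esub> ?c w"
      using Cons pres_class_mult[of "[i]" "{1..n}" w] by (simp add: kiselman_gen_def kiselman_def)
    have "?c w \<in> carrier (kiselman n)"
      using Cons by (simp add: kiselman_def pres_class_closed)
    then show ?case
      unfolding eq using Cons kiselman_gen_closed kiselman_iso_gen[OF h b]
      by (simp add: hom_mult[OF h])
  qed
  then show ?thesis
    using w by simp
qed

lemma auto_kiselman: "auto (kiselman n) = {\<lambda>x\<in>carrier (kiselman n). x}"
proof (intro equalityI subsetI)
  fix h assume "h \<in> auto (kiselman n)"
  then have h: "h \<in> hom (kiselman n) (kiselman n)" "h \<in> Bij (carrier (kiselman n))"
    by (auto simp: auto_def)
  then have "h x = x" if "x \<in> carrier (kiselman n)" for x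
    using that by (intro kiselman_iso_id) (auto simp: Bij_def)
  then show "h \<in> {\<lambda>x\<in>carrier (kiselman n). x}"
    using Bij_imp_extensional[OF h(2)] by (auto intro: extensionalityI)
next
  fix h assume "h \<in> {\<lambda>x\<in>carrier (kiselman n). x}"
  then show "h \<in> auto (kiselman n)"
    by (auto simp: auto_def hom_def id_Bij monoid.m_closed[OF monoid_kiselman])
qed

section \<open>Word reversal and antiautomorphisms\<close>

definition reverse_word :: "nat \<Rightarrow> nat list \<Rightarrow> nat list"
  where "reverse_word n w = rev (map (\<lambda>i. n - i + 1) w)"

lemma reverse_word_append: "reverse_word n (u @ v) = reverse_word n v @ reverse_word n u"
  by (simp add: reverse_word_def)

lemma reverse_word_lists: "w \<in> lists {1..n} \<Longrightarrow> reverse_word n w \<in> lists {1..n}"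
  by (auto simp: reverse_word_def in_lists_conv_set)

text \<open>With truncated subtraction the letter map \<open>n - i + 1\<close> is an involution on
  \<open>{1..n}\<close>, but not on all of \<open>nat\<close>.\<close>

lemma reverse_word_reverse_word: "w \<in> lists {1..n} \<Longrightarrow> reverse_word n (reverse_word n w) = w"
  by (induction w) (auto simp: reverse_word_def)

text \<open>Reversal alone would put the smaller letter first in \<open>[j, i]\<close>; flipping the
  indices makes the first letter the larger one again. The left sides are palindromes, so the two
  families of two-letter relations are exchanged.\<close>

lemma kiselman_rels_reverse_word:
  assumes "(u, v) \<in> kiselman_rels n"
  shows "(reverse_word n u, reverse_word n v) \<in> kiselman_rels n"
proof -
  consider i where "u = [i, i]" "v = [i]" "i \<in> {1..n}"
    | i j where "u = [i, j, i]" "v = [j, i]" "1 \<le> i" "i < j" "j \<le> n"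
    | i j where "u = [j, i, j]" "v = [j, i]" "1 \<le> i" "i < j" "j \<le> n"
    using assms by (auto simp: kiselman_rels_def)
  then show ?thesis
  proof cases
    case 1
    then show ?thesis
      by (auto simp: kiselman_rels_def reverse_word_def)
  next
    case 2
    then have "1 \<le> n - j + 1" "n - j + 1 < n - i + 1" "n - i + 1 \<le> n"
      by auto
    then show ?thesis
      using 2 unfolding kiselman_rels_def reverse_word_def by simp
  next
    case 3
    then have "1 \<le> n - j + 1" "n - j + 1 < n - i + 1" "n - i + 1 \<le> n"
      by auto
    then show ?thesis
      using 3 unfolding kiselman_rels_def reverse_word_def by simp
  qed
qed

lemma pres_cong_reverse_word:
  assumes "(u, v) \<in> pres_cong {1..n} (kiselman_rels n)"
  shows "(reverse_word n u, reverse_word n v) \<in> pres_cong {1..n} (kiselman_rels n)"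
  using assms
proof induction
  case (refl u)
  then show ?case
    by (intro pres_cong.refl reverse_word_lists)
next
  case (sym u v)
  show ?case
    by (rule pres_cong.sym[OF sym.IH])
next
  case (trans u v w)
  show ?case
    by (rule pres_cong.trans[OF trans.IH])
next
  case (rel u v x y)
  then show ?case
    using pres_cong.rel[OF kiselman_rels_reverse_word[OF rel(1)]] reverse_word_lists
    by (simp add: reverse_word_append)
qed

text \<open>The image fills a whole class because reversal is an involution respecting the
  congruence. Hence the map on classes can be defined by images, without choosing
  representatives.\<close>

lemma reverse_word_image_pres_class:
  assumes w: "w \<in> lists {1..n}"
  shows "reverse_word n ` pres_class {1..n} (kiselman_rels n) w =
    pres_class {1..n} (kiselman_rels n) (reverse_word n w)"
proof (intro equalityI subsetI)
  fix u assume "u \<in> reverse_word n ` pres_class {1..n} (kiselman_rels n) w"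
  then show "u \<in> pres_class {1..n} (kiselman_rels n) (reverse_word n w)"
    by (auto simp: pres_class_def intro: pres_cong_reverse_word)
next
  fix u assume "u \<in> pres_class {1..n} (kiselman_rels n) (reverse_word n w)"
  then have u: "(reverse_word n w, u) \<in> pres_cong {1..n} (kiselman_rels n)"
    by (simp add: pres_class_def)
  then have "reverse_word n u \<in> pres_class {1..n} (kiselman_rels n) w"
    using pres_cong_reverse_word[OF u] w by (simp add: pres_class_def reverse_word_reverse_word)
  moreover have "u = reverse_word n (reverse_word n u)"
    using pres_cong_lists[OF u] by (simp add: reverse_word_reverse_word)
  ultimately show "u \<in> reverse_word n ` pres_class {1..n} (kiselman_rels n) w"
    by blast
qed

definition kiselman_reversal :: "nat \<Rightarrow> nat list set \<Rightarrow> nat list set"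
  where "kiselman_reversal n = (\<lambda>X\<in>carrier (kiselman n). reverse_word n ` X)"

lemma kiselman_reversal_pres_class:
  "w \<in> lists {1..n} \<Longrightarrow> kiselman_reversal n (pres_class {1..n} (kiselman_rels n) w) =
    pres_class {1..n} (kiselman_rels n) (reverse_word n w)"
  by (simp add: kiselman_reversal_def kiselman_def pres_class_closed reverse_word_image_pres_class)

lemma kiselman_reversal_closed:
  "x \<in> carrier (kiselman n) \<Longrightarrow> kiselman_reversal n x \<in> carrier (kiselman n)"
  by (erule carrier_kiselmanE)
    (simp add: kiselman_reversal_pres_class kiselman_def pres_class_closed reverse_word_lists)

lemma kiselman_reversal_involution:
  "x \<in> carrier (kiselman n) \<Longrightarrow> kiselman_reversal n (kiselman_reversal n x) = x"
  by (erule carrier_kiselmanE)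
    (simp add: kiselman_reversal_pres_class reverse_word_lists reverse_word_reverse_word)

lemma kiselman_reversal_gen:
  "i \<in> {1..n} \<Longrightarrow> kiselman_reversal n (kiselman_gen n i) = kiselman_gen n (n - i + 1)"
  by (simp add: kiselman_gen_def kiselman_reversal_pres_class reverse_word_def)

lemma kiselman_reversal_mult:
  assumes "x \<in> carrier (kiselman n)" "y \<in> carrier (kiselman n)"
  shows "kiselman_reversal n (x \<otimes>\<^bsub>kiselman n\<^esub> y) =
    kiselman_reversal n y \<otimes>\<^bsub>kiselman n\<^esub> kiselman_reversal n x"
proof -
  obtain u v where uv: "u \<in> lists {1..n}" "v \<in> lists {1..n}"
    "x = pres_class {1..n} (kiselman_rels n) u" "y = pres_class {1..n} (kiselman_rels n) v"
    using assms by (metis carrier_kiselmanE)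
  then have "u @ v \<in> lists {1..n}"
    by simp
  with uv show ?thesis
    using reverse_word_lists[OF uv(1)] reverse_word_lists[OF uv(2)]
    by (simp add: kiselman_def pres_class_mult kiselman_reversal_pres_class reverse_word_append
        del: append_in_lists_conv)
qed

lemma kiselman_reversal_bij:
  "bij_betw (kiselman_reversal n) (carrier (kiselman n)) (carrier (kiselman n))"
  by (rule bij_betw_byWitness[where f' = "kiselman_reversal n"])
    (auto simp: kiselman_reversal_involution kiselman_reversal_closed)

lemma kiselman_reversal_antiauto: "kiselman_reversal n \<in> antiauto (kiselman n)"
  by (auto simp: antiauto_def Bij_def kiselman_reversal_bij kiselman_reversal_mult)
    (simp add: kiselman_reversal_def)

lemma antiauto_kiselman: "antiauto (kiselman n) = {kiselman_reversal n}"
proof (intro equalityI subsetI)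
  let ?C = "carrier (kiselman n)" and ?r = "kiselman_reversal n"
  fix s assume "s \<in> antiauto (kiselman n)"
  then have ext: "s \<in> extensional ?C" and b: "bij_betw s ?C ?C"
    and mult: "\<And>x y. x \<in> ?C \<Longrightarrow> y \<in> ?C \<Longrightarrow> s (x \<otimes>\<^bsub>kiselman n\<^esub> y) = s y \<otimes>\<^bsub>kiselman n\<^esub> s x"
    by (auto simp: antiauto_def Bij_def)
  have closed: "s x \<in> ?C" if "x \<in> ?C" for x
    using b that by (rule bij_betwE[rule_format])
  have "?r \<circ> s \<in> hom (kiselman n) (kiselman n)"
    by (rule homI) (auto simp: closed mult kiselman_reversal_closed kiselman_reversal_mult)
  moreover have "bij_betw (?r \<circ> s) ?C ?C"
    by (rule bij_betw_trans[OF b kiselman_reversal_bij])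
  \<comment> \<open>The two reversals of the order of factors cancel, so rigidity applies to
    \<open>?r \<circ> s\<close>.\<close>
  ultimately have "?r (s x) = x" if "x \<in> ?C" for x
    using kiselman_iso_id[of "?r \<circ> s" n x] that by simp
  \<comment> \<open>Apply the involution \<open>?r\<close> to both sides.\<close>
  then have "s x = ?r x" if "x \<in> ?C" for x
    using kiselman_reversal_involution[OF closed[OF that]] that by simp
  then have "s = ?r"
    by (intro extensionalityI[OF ext]) (auto simp: kiselman_reversal_def)
  then show "s \<in> {?r}"
    by simp
qed (simp add: kiselman_reversal_antiauto)

theorem proposition20:
  fixes n :: nat
  assumes "n \<ge> 1"
  shows "auto (kiselman n) = {\<lambda>x\<in>carrier (kiselman n). x} \<and>
    (\<exists>!\<sigma>. \<sigma> \<in> antiauto (kiselman n) \<and>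
       (\<forall>i\<in>{1..n}. \<sigma> (kiselman_gen n i) = kiselman_gen n (n - i + 1))) \<and>
    (\<forall>\<sigma>. \<sigma> \<in> antiauto (kiselman n) \<and>
       (\<forall>i\<in>{1..n}. \<sigma> (kiselman_gen n i) = kiselman_gen n (n - i + 1)) \<longrightarrow>
       antiauto (kiselman n) = {\<sigma>})"
  \<comment> \<open>With the set of antiautomorphisms a singleton, part (b) comes down to the values
    of \<open>kiselman_reversal n\<close> on the generators.\<close>
  unfolding antiauto_kiselman
  using auto_kiselman kiselman_reversal_gen by auto

end
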